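(* Let $P=(p_{ij})_{i,j\in S}$ be a Markov transition matrix on a finite set $S$ satisfying the standing assumptions (1)–(4) listed in the context, let $n=|S|$, let $\mu$ be the uniform distribution on $S$, and let $\delta=\min\{p_{ij}: i,j\in S,\ p_{ij}>0\}$. Let $f:S\to S$ be a bijection, and let $Q=\Pi P$, where $\Pi$ is the permutation matrix of $f$. For $A\subseteq S$ let $\mathcal{E}(A)$ be the set of $j\in S$ such that $p_{ij}>0$ for some $i\in A$. Suppose that there is some $\epsilon\in(0,1)$ such that for every $A\subseteq S$ with $|A|\le n/2$, $$|\mathcal{E}(f(\mathcal{E}(A)))|\ge (1+\epsilon)|A|.$$ Let $X_0,X_1,\ldots$ be a Markov chain with transition matrix $Q$, and for each $i\in S$ and $k\ge 1$ let $\mu_i^k$ be the law of $X_k$ given $X_0=i$. Then for all $i\in S$ and $k\ge 1$, $$\|\mu_i^k-\mu\|_{TV}\le \frac{\sqrt{n}}{2}\Bigl(1-\frac{\epsilon^2\delta^8}{2}\Bigr)^{(k-2)/4},$$ where $\|\cdot\|_{TV}$ denotes total variation distance.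
   Context: Standing assumptions on $P$: (1) the Markov chain generated by $P$ is irreducible and aperiodic; (2) if $p_{ij}>0$ for some $i,j\in S$ then $p_{ji}>0$; (3) $p_{ii}>0$ for each $i\in S$; (4) the uniform distribution $\mu$ on $S$ is the stationary measure of $P$. The permutation matrix $\Pi=(\pi_{ij})_{i,j\in S}$ of $f$ has $\pi_{ij}=1$ if $j=f(i)$ and $\pi_{ij}=0$ otherwise; so one step of the $Q$-chain applies $f$ and then takes one step according to $P$. For $B\subseteq S$, $f(B)$ is the image of $B$. Total variation distance: $\|\nu-\mu\|_{TV}=\frac12\sum_{j\in S}|\nu(j)-\mu(j)|$. *)

theory Defs
  imports "HOL-Probability.Probability"
begin

definition transition_matrix :: "real ^ 's ^ 's \<Rightarrow> bool" where
  "transition_matrix P \<longleftrightarrow> (\<forall>i j. 0 \<le> P $ i $ j) \<and> (\<forall>i. (\<Sum>j\<in>UNIV. P $ i $ j) = 1)"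

(* The class instance for (^) on vectors is componentwise, so powers of the
   matrix product (**) need a constant of their own. *)
primrec matrix_power :: "real ^ 's ^ 's \<Rightarrow> nat \<Rightarrow> real ^ 's ^ 's" where
  "matrix_power P 0 = mat 1"
| "matrix_power P (Suc k) = P ** matrix_power P k"

definition irreducible_matrix :: "real ^ 's ^ 's \<Rightarrow> bool" where
  "irreducible_matrix P \<longleftrightarrow> (\<forall>i j. \<exists>k. matrix_power P k $ i $ j > 0)"

definition aperiodic_matrix :: "real ^ 's ^ 's \<Rightarrow> bool" where
  "aperiodic_matrix P \<longleftrightarrow> (\<forall>i. Gcd {k. k \<ge> 1 \<and> matrix_power P k $ i $ i > 0} = 1)"

definition stationary :: "('s \<Rightarrow> real) \<Rightarrow> real ^ 's ^ 's \<Rightarrow> bool" where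
  "stationary \<nu> P \<longleftrightarrow> (\<forall>j. (\<Sum>i\<in>UNIV. \<nu> i * P $ i $ j) = \<nu> j)"

definition uniform :: "'s::finite \<Rightarrow> real" where
  "uniform j = 1 / real CARD('s)"

definition permutation_matrix :: "('s \<Rightarrow> 's) \<Rightarrow> real ^ 's ^ 's" where
  "permutation_matrix f = (\<chi> i j. if j = f i then 1 else 0)"

definition min_pos_entry :: "real ^ 's ^ 's \<Rightarrow> real" where
  "min_pos_entry P = Min {P $ i $ j | i j. P $ i $ j > 0}"

definition expansion :: "real ^ 's ^ 's \<Rightarrow> 's set \<Rightarrow> 's set" where
  "expansion P A = {j. \<exists>i\<in>A. P $ i $ j > 0}"

definition tv_dist :: "('s::finite \<Rightarrow> real) \<Rightarrow> ('s \<Rightarrow> real) \<Rightarrow> real" where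
  "tv_dist \<nu> \<mu> = 1 / 2 * (\<Sum>j\<in>UNIV. \<bar>\<nu> j - \<mu> j\<bar>)"

(* The initial distribution is arbitrary; the guard excludes conditioning on null histories. *)
definition markov_chain ::
  "'w measure \<Rightarrow> (nat \<Rightarrow> 'w \<Rightarrow> 's) \<Rightarrow> real ^ 's ^ 's \<Rightarrow> bool" where
  "markov_chain M X Q \<longleftrightarrow>
     prob_space M \<and>
     (\<forall>k. X k \<in> measurable M (count_space UNIV)) \<and>
     (\<forall>k x j. \<P>(\<omega> in M. \<forall>m\<le>k. X m \<omega> = x m) > 0 \<longrightarrow>
        \<P>(\<omega> in M. X (Suc k) \<omega> = j \<bar> (\<forall>m\<le>k. X m \<omega> = x m)) = Q $ x k $ j)"

definition law_given_start ::
  "'w measure \<Rightarrow> (nat \<Rightarrow> 'w \<Rightarrow> 's) \<Rightarrow> 's \<Rightarrow> nat \<Rightarrow> 's \<Rightarrow> real" where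
  "law_given_start M X i k = (\<lambda>j. \<P>(\<omega> in M. X k \<omega> = j \<bar> X 0 \<omega> = i))"

end

theory Submission
  imports Defs
begin

text \<open>
  Write $\Pi$ for the permutation matrix of $f$, and let distributions be row vectors. The
  deviation of the law of the chain from uniform has mean zero and evolves by multiplication with
  $Q = \Pi P$. Two steps multiply by $\Pi K$ with $K = P \Pi P$. As $\Pi$ is an isometry that
  preserves the mean, it is enough to show that $K$ contracts mean-zero vectors in the Euclidean
  norm (\<open>block_contraction\<close>). One factor for every two steps, and Cauchy-Schwarz to pass from the
  Euclidean norm to total variation (\<open>tv_dist_le_norm\<close>), then give the bound: after $k$ steps the
  squared norm has shrunk by at least $k \mathbin{div} 2$ factors, so the norm carries the exponent
  $(k \mathbin{div} 2)/2 \ge (k-2)/4$.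

  The matrix $L = K K^T$ is symmetric and doubly stochastic, and
  $\|v K\|^2 = \langle v, L v\rangle = \|v\|^2 - \mathcal{D}(v)$ with the Dirichlet form $\mathcal{D}$
  of $L$. So the contraction amounts to a spectral gap of $L$. Cheeger's inequality
  (\<open>cheeger_inequality\<close>) turns an isoperimetric bound for $L$ into that gap:
  if at least $h |A|$ flows out of each set $A$ of at most half of the states, then
  $\mathcal{D}(v) \ge (h^2/2) \|v\|^2$ for mean-zero $v$.

  The isoperimetric bound holds with $h = \epsilon \delta^4$. The states that $L$ reaches from $A$
  number at least $(1+\epsilon)|A|$: the factor $K$ achieves this by hypothesis, and $K^T$ cannot
  reduce it, because $f^{-1}$ is injective and every state has a loop in $P$. Hence at least
  $\epsilon |A|$ of them lie outside $A$, and each receives at least $\delta^4$, since $L$ is a product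
  with four factors $P$ (\<open>boundary_flow_ge\<close>). Then $h^2/2 = \epsilon^2\delta^8/2$.
\<close>

section \<open>Dirichlet forms and Cheeger's inequality\<close>

definition dirichlet_form :: "real ^ 's ^ 's \<Rightarrow> ('s \<Rightarrow> real) \<Rightarrow> real" where
  "dirichlet_form L g = (\<Sum>i\<in>UNIV. \<Sum>j\<in>UNIV. L $ i $ j * (g i - g j)\<^sup>2) / 2"

definition boundary_flow :: "real ^ 's ^ 's \<Rightarrow> 's set \<Rightarrow> real" where
  "boundary_flow L A = (\<Sum>i\<in>A. \<Sum>j\<in>-A. L $ i $ j)"

definition doubly_stochastic :: "real ^ 's ^ 's \<Rightarrow> bool" where
  "doubly_stochastic L \<longleftrightarrow> transition_matrix L \<and> transition_matrix (transpose L)"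

lemma doubly_stochasticD:
  assumes "doubly_stochastic L"
  shows "0 \<le> L $ i $ j" "(\<Sum>j\<in>UNIV. L $ i $ j) = 1" "(\<Sum>i\<in>UNIV. L $ i $ j) = 1"
  using assms by (auto simp: doubly_stochastic_def transition_matrix_def transpose_def)

lemma dirichlet_form_nonneg:
  assumes "doubly_stochastic L"
  shows "0 \<le> dirichlet_form L g"
  unfolding dirichlet_form_def
  by (intro divide_nonneg_nonneg sum_nonneg mult_nonneg_nonneg)
    (auto simp: doubly_stochasticD[OF assms])

lemma doubly_stochastic_sum_left:
  assumes "doubly_stochastic L"
  shows "(\<Sum>i\<in>UNIV. \<Sum>j\<in>UNIV. L $ i $ j * h i) = (\<Sum>i\<in>UNIV. h i)"
  by (simp flip: sum_distrib_right add: doubly_stochasticD[OF assms])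

lemma doubly_stochastic_sum_right:
  assumes "doubly_stochastic L"
  shows "(\<Sum>i\<in>UNIV. \<Sum>j\<in>UNIV. L $ i $ j * h j) = (\<Sum>j\<in>UNIV. h j)"
  by (subst sum.swap) (simp flip: sum_distrib_right add: doubly_stochasticD[OF assms])

text \<open>
  Expanding the squares in the Dirichlet form leaves two diagonal terms and a cross term; the row sums
  and the column sums turn the diagonal terms into squared norms.
\<close>

lemma inner_doubly_stochastic_eq:
  assumes "doubly_stochastic L"
  shows "v \<bullet> (L *v v) = (norm v)\<^sup>2 - dirichlet_form L (vec_nth v)"
proof -
  have "2 * dirichlet_form L (vec_nth v) = (\<Sum>i\<in>UNIV. \<Sum>j\<in>UNIV. L $ i $ j * (v $ i)\<^sup>2
        + L $ i $ j * (v $ j)\<^sup>2 - 2 * (v $ i * (L $ i $ j * v $ j)))"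
    by (simp add: dirichlet_form_def power2_eq_square algebra_simps)
  also have "\<dots>
      = (\<Sum>i\<in>UNIV. \<Sum>j\<in>UNIV. L $ i $ j * (v $ i)\<^sup>2) + (\<Sum>i\<in>UNIV. \<Sum>j\<in>UNIV. L $ i $ j * (v $ j)\<^sup>2)
        - 2 * (\<Sum>i\<in>UNIV. \<Sum>j\<in>UNIV. v $ i * (L $ i $ j * v $ j))"
    by (simp add: sum.distrib sum_subtractf sum_distrib_left)
  also have "\<dots> = 2 * (\<Sum>i\<in>UNIV. (v $ i)\<^sup>2) - 2 * (v \<bullet> (L *v v))"
    unfolding doubly_stochastic_sum_left[OF assms] doubly_stochastic_sum_right[OF assms]
    by (simp add: inner_vec_def matrix_vector_mult_def sum_distrib_left)
  also have "(\<Sum>i\<in>UNIV. (v $ i)\<^sup>2) = (norm v)\<^sup>2"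
    by (simp add: power2_norm_eq_inner) (simp add: inner_vec_def power2_eq_square)
  finally show ?thesis by simp
qed

text \<open>
  A nonnegative function is a superposition of indicators of its superlevel sets, and the right-hand
  side is the corresponding superposition of their boundary flows. Peeling off the layer
  of height $\min \{w_i : w_i > 0\}$ over the support makes the support smaller, so the superposition
  becomes an induction and needs no integral over levels.
\<close>

lemma coarea_inequality:
  fixes L :: "real ^ 's ^ 's" and w :: "'s \<Rightarrow> real" and h :: real
  assumes nn: "\<And>i. 0 \<le> w i"
    and flow: "\<And>A. A \<subseteq> {i. 0 < w i} \<Longrightarrow> h * card A \<le> boundary_flow L A"
  shows "h * (\<Sum>i\<in>UNIV. w i) \<le> (\<Sum>i\<in>UNIV. \<Sum>j\<in>UNIV. L $ i $ j * max (w i - w j) 0)"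
  using assms
proof (induction "card {i. 0 < w i}" arbitrary: w rule: less_induct)
  case less
  define A where "A = {i. 0 < w i}"
  show ?case
  proof (cases "A = {}")
    case True
    then have "w i = 0" for i
      using less.prems(1)[of i] by (auto simp: A_def not_less intro: antisym)
    then show ?thesis by simp
  next
    case False
    define m where "m = Min (w ` A)"
    have m_le: "m \<le> w i" if "i \<in> A" for i
      using that by (auto simp: m_def)
    have "m \<in> w ` A"
      using False by (auto simp: m_def intro!: Min_in)
    then obtain a where a: "a \<in> A" "w a = m" by auto
    then have "0 < m" by (auto simp: A_def)
    define w' where "w' i = w i - (if i \<in> A then m else 0)" for i
    have w0: "w i = 0" if "i \<notin> A" for i
      using that less.prems(1)[of i] by (auto simp: A_def)
    have w'nn: "0 \<le> w' i" for i
      using m_le w0 by (auto simp: w'_def)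
    have sub: "{i. 0 < w' i} \<subseteq> A"
      using w0 by (auto simp: w'_def split: if_splits)
    moreover have "a \<notin> {i. 0 < w' i}"
      using a by (simp add: w'_def)
    ultimately have "card {i. 0 < w' i} < card A"
      using a by (intro psubset_card_mono) auto
    then have IH: "h * (\<Sum>i\<in>UNIV. w' i) \<le> (\<Sum>i\<in>UNIV. \<Sum>j\<in>UNIV. L $ i $ j * max (w' i - w' j) 0)"
      using sub by (intro less.hyps w'nn less.prems(2)) (auto simp: A_def)
    have split: "L $ i $ j * max (w i - w j) 0
        = L $ i $ j * max (w' i - w' j) 0 + (if i \<in> A then if j \<in> - A then L $ i $ j * m else 0 else 0)" for i j
      using w0[of i] w0[of j] m_le[of i] m_le[of j] less.prems(1)[of i] less.prems(1)[of j] \<open>0 < m\<close>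
      by (auto simp: w'_def max_def algebra_simps)
    have flow_eq: "(\<Sum>i\<in>UNIV. \<Sum>j\<in>UNIV. if i \<in> A then if j \<in> - A then L $ i $ j * m else 0 else 0)
        = m * boundary_flow L A"
    proof -
      have "(\<Sum>j\<in>UNIV. if i \<in> A then if j \<in> - A then L $ i $ j * m else 0 else 0)
          = (if i \<in> A then \<Sum>j\<in>-A. L $ i $ j * m else 0)" for i
        by (simp add: sum.If_cases Compl_eq)
      then show ?thesis
        by (simp add: sum.If_cases boundary_flow_def sum_distrib_left mult.commute)
    qed
    have "h * (\<Sum>i\<in>UNIV. w i) = h * (\<Sum>i\<in>UNIV. w' i) + m * (h * card A)"
      by (simp add: w'_def sum_subtractf sum.If_cases algebra_simps)
    also have "\<dots> \<le> (\<Sum>i\<in>UNIV. \<Sum>j\<in>UNIV. L $ i $ j * max (w' i - w' j) 0) + m * boundary_flow L A"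
      using IH less.prems(2)[of A] \<open>0 < m\<close> by (intro add_mono mult_left_mono) (auto simp: A_def)
    also have "\<dots> = (\<Sum>i\<in>UNIV. \<Sum>j\<in>UNIV. L $ i $ j * max (w i - w j) 0)"
      unfolding split sum.distrib flow_eq ..
    finally show ?thesis .
  qed
qed

text \<open>
  The coarea inequality applies to $g^2$, whose superlevel sets are contained in the support of $g$.
  With $G = \sum_i g_i^2$ and $T = \sum_{i,j} L_{ij} |g_i^2 - g_j^2|$ it gives $2 h G \le T$. Factoring
  $g_i^2 - g_j^2 = (g_i - g_j)(g_i + g_j)$, Cauchy-Schwarz bounds $T^2$ by
  $2 \mathcal{D}(g) \cdot 4 G$.
\<close>

lemma cheeger_small_support:
  fixes L :: "real ^ 's ^ 's" and g :: "'s \<Rightarrow> real" and h :: real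
  assumes ds: "doubly_stochastic L" and sym: "transpose L = L"
    and nn: "\<And>i. 0 \<le> g i" and "0 \<le> h"
    and flow: "\<And>A. A \<subseteq> {i. 0 < g i} \<Longrightarrow> h * card A \<le> boundary_flow L A"
  shows "h\<^sup>2 / 2 * (\<Sum>i\<in>UNIV. (g i)\<^sup>2) \<le> dirichlet_form L g"
proof -
  let ?I = "UNIV \<times> (UNIV :: 's set)"
  define G where "G = (\<Sum>i\<in>UNIV. (g i)\<^sup>2)"
  define T where "T = (\<Sum>i\<in>UNIV. \<Sum>j\<in>UNIV. L $ i $ j * \<bar>(g i)\<^sup>2 - (g j)\<^sup>2\<bar>)"
  have L_sym: "L $ i $ j = L $ j $ i" for i j
    using sym by (metis transpose_def vec_lambda_beta)
  have L0: "0 \<le> L $ i $ j" for i j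
    using ds by (rule doubly_stochasticD)
  have "G \<ge> 0" by (simp add: G_def sum_nonneg)
  have "h * G \<le> (\<Sum>i\<in>UNIV. \<Sum>j\<in>UNIV. L $ i $ j * max ((g i)\<^sup>2 - (g j)\<^sup>2) 0)"
    unfolding G_def
  proof (rule coarea_inequality)
    fix A assume "A \<subseteq> {i. 0 < (g i)\<^sup>2}"
    with nn show "h * card A \<le> boundary_flow L A"
      by (intro flow) (auto simp: less_le)
  qed simp
  (* Each unordered pair is counted once in the one-sided sum and, by symmetry, twice in T. *)
  also have "2 * \<dots> = T"
  proof -
    have "T = (\<Sum>i\<in>UNIV. \<Sum>j\<in>UNIV. L $ i $ j * max ((g i)\<^sup>2 - (g j)\<^sup>2) 0)
            + (\<Sum>i\<in>UNIV. \<Sum>j\<in>UNIV. L $ i $ j * max ((g j)\<^sup>2 - (g i)\<^sup>2) 0)"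
      unfolding T_def sum.distrib[symmetric] distrib_left[symmetric]
      by (intro sum.cong refl arg_cong2[of _ _ _ _ times]) (simp add: max_def)
    also have "(\<Sum>i\<in>UNIV. \<Sum>j\<in>UNIV. L $ i $ j * max ((g j)\<^sup>2 - (g i)\<^sup>2) 0)
        = (\<Sum>i\<in>UNIV. \<Sum>j\<in>UNIV. L $ i $ j * max ((g i)\<^sup>2 - (g j)\<^sup>2) 0)"
      using L_sym by (subst sum.swap) (intro sum.cong refl arg_cong2[of _ _ _ _ times])
    finally show ?thesis by simp
  qed
  finally have T_ge: "2 * h * G \<le> T" by simp
  have "T = (\<Sum>(i, j)\<in>?I. (sqrt (L $ i $ j) * \<bar>g i - g j\<bar>) * (sqrt (L $ i $ j) * (g i + g j)))"
  proof -
    have "L $ i $ j * \<bar>(g i)\<^sup>2 - (g j)\<^sup>2\<bar>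
        = (sqrt (L $ i $ j) * \<bar>g i - g j\<bar>) * (sqrt (L $ i $ j) * (g i + g j))" for i j
    proof -
      have "\<bar>(g i)\<^sup>2 - (g j)\<^sup>2\<bar> = \<bar>g i - g j\<bar> * (g i + g j)"
        using nn[of i] nn[of j] by (simp add: power2_eq_square square_diff_square_factored abs_mult)
      then have "L $ i $ j * \<bar>(g i)\<^sup>2 - (g j)\<^sup>2\<bar>
          = (sqrt (L $ i $ j) * sqrt (L $ i $ j)) * (\<bar>g i - g j\<bar> * (g i + g j))"
        by (simp add: L0)
      then show ?thesis by (simp only: mult_ac)
    qed
    then show ?thesis unfolding T_def sum.cartesian_product by simp
  qed
  then have "T\<^sup>2 \<le> (\<Sum>(i, j)\<in>?I. (sqrt (L $ i $ j) * \<bar>g i - g j\<bar>)\<^sup>2) * (\<Sum>(i, j)\<in>?I. (sqrt (L $ i $ j) * (g i + g j))\<^sup>2)"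
    using Cauchy_Schwarz_ineq_sum[of "\<lambda>(i, j). sqrt (L $ i $ j) * \<bar>g i - g j\<bar>" "\<lambda>(i, j). sqrt (L $ i $ j) * (g i + g j)" ?I]
    by (simp add: case_prod_unfold)
  also have "(\<Sum>(i, j)\<in>?I. (sqrt (L $ i $ j) * \<bar>g i - g j\<bar>)\<^sup>2) = 2 * dirichlet_form L g"
    by (simp add: dirichlet_form_def sum.cartesian_product power_mult_distrib L0)
  also have "(\<Sum>(i, j)\<in>?I. (sqrt (L $ i $ j) * (g i + g j))\<^sup>2) \<le> 4 * G"
  proof -
    have "(\<Sum>(i, j)\<in>?I. (sqrt (L $ i $ j) * (g i + g j))\<^sup>2)
        = (\<Sum>i\<in>UNIV. \<Sum>j\<in>UNIV. L $ i $ j * (g i + g j)\<^sup>2)"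
      by (simp add: sum.cartesian_product power_mult_distrib L0)
    also have "\<dots> \<le> (\<Sum>i\<in>UNIV. \<Sum>j\<in>UNIV. L $ i $ j * (2 * (g i)\<^sup>2) + L $ i $ j * (2 * (g j)\<^sup>2))"
    proof (intro sum_mono)
      fix i j
      have "(g i + g j)\<^sup>2 \<le> 2 * (g i)\<^sup>2 + 2 * (g j)\<^sup>2"
        using zero_le_power2[of "g i - g j"] by (simp add: power2_eq_square algebra_simps)
      then show "L $ i $ j * (g i + g j)\<^sup>2 \<le> L $ i $ j * (2 * (g i)\<^sup>2) + L $ i $ j * (2 * (g j)\<^sup>2)"
        unfolding distrib_left[symmetric] by (rule mult_left_mono[OF _ L0])
    qed
    also have "\<dots> = 4 * G"
      unfolding sum.distrib doubly_stochastic_sum_left[OF ds] doubly_stochastic_sum_right[OF ds]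
      by (simp add: G_def flip: sum_distrib_left)
    finally show ?thesis .
  qed
  finally have T_le: "T\<^sup>2 \<le> 8 * (dirichlet_form L g * G)"
    using dirichlet_form_nonneg[OF ds, of g] by (simp add: mult_left_mono)
  have "8 * (G * (h\<^sup>2 / 2 * G)) = (2 * h * G)\<^sup>2"
    by (simp add: power2_eq_square)
  also have "\<dots> \<le> T\<^sup>2"
    using T_ge \<open>0 \<le> h\<close> \<open>0 \<le> G\<close> by (intro power_mono) auto
  also note T_le
  also have "8 * (dirichlet_form L g * G) = 8 * (G * dirichlet_form L g)"
    by simp
  finally have G_le: "G * (h\<^sup>2 / 2 * G) \<le> G * dirichlet_form L g"
    by (rule mult_left_le_imp_le) simp
  have "h\<^sup>2 / 2 * G \<le> dirichlet_form L g" if "G \<noteq> 0"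
    by (rule mult_left_le_imp_le[OF G_le]) (use that \<open>0 \<le> G\<close> in simp)
  moreover have "h\<^sup>2 / 2 * G \<le> dirichlet_form L g" if "G = 0"
    using that dirichlet_form_nonneg[OF ds, of g] by simp
  ultimately show ?thesis unfolding G_def by blast
qed

text \<open>
  The least value with at most half of the points strictly above it is a median: were more than half
  of the points below it, the next smaller value would also qualify.
\<close>

lemma median_exists:
  fixes v :: "'s::finite \<Rightarrow> real"
  obtains c where "2 * card {i. c < v i} \<le> CARD('s)" "2 * card {i. v i < c} \<le> CARD('s)"
proof -
  define C where "C = {c \<in> range v. 2 * card {i. c < v i} \<le> CARD('s)}"
  have "Max (range v) \<in> C"
  proof -
    have "{i. Max (range v) < v i} = {}"
      by (auto simp: not_less)
    then show ?thesis
      by (simp only: C_def mem_Collect_eq card.empty) (auto intro!: Max_in)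
  qed
  then have ne: "C \<noteq> {}" by auto
  define c where "c = Min C"
  have "c \<in> C" unfolding c_def using ne by (intro Min_in) (auto simp: C_def)
  moreover have "2 * card {i. v i < c} \<le> CARD('s)"
  proof (rule ccontr)
    assume *: "\<not> 2 * card {i. v i < c} \<le> CARD('s)"
    then have ne': "{i. v i < c} \<noteq> {}" by (metis card.empty mult_0_right zero_le)
    define b where "b = Max (v ` {i. v i < c})"
    have "b \<in> v ` {i. v i < c}"
      unfolding b_def using ne' by (intro Max_in) auto
    then have b: "b \<in> range v" "b < c" by auto
    have "{i. b < v i} \<subseteq> - {i. v i < c}"
    proof (intro subsetI ComplI)
      fix i assume i: "i \<in> {i. b < v i}" "i \<in> {i. v i < c}"
      have "v i \<le> b"
        unfolding b_def using i by (intro Max_ge) auto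
      then show False using i by simp
    qed
    then have "card {i. b < v i} \<le> CARD('s) - card {i. v i < c}"
      by (metis card_mono finite card_Diff_subset Compl_eq_Diff_UNIV subset_UNIV)
    then have "b \<in> C" using * b by (auto simp: C_def)
    then have "c \<le> b" by (auto simp: c_def C_def)
    then show False using b by simp
  qed
  ultimately show thesis using that[of c] by (auto simp: C_def)
qed

text \<open>
  Subtracting a median $c$ leaves the Dirichlet form unchanged and can only increase the norm of a
  mean-zero vector, since the mean minimises $\sum_i (v_i - c)^2$. The positive and the
  negative part of $v - c$ each have support on at most half of the states, so the previous bound
  applies to both, and splitting into these parts does not increase the Dirichlet form.
\<close>

lemma cheeger_inequality:
  fixes L :: "real ^ 's ^ 's" and v :: "real ^ 's" and h :: real
  assumes ds: "doubly_stochastic L" and sym: "transpose L = L" and "0 \<le> h"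
    and flow: "\<And>A. 2 * card A \<le> CARD('s) \<Longrightarrow> h * card A \<le> boundary_flow L A"
    and mean_zero: "(\<Sum>i\<in>UNIV. v $ i) = 0"
  shows "h\<^sup>2 / 2 * (norm v)\<^sup>2 \<le> dirichlet_form L (vec_nth v)"
proof -
  obtain c where c: "2 * card {i. c < v $ i} \<le> CARD('s)" "2 * card {i. v $ i < c} \<le> CARD('s)"
    using median_exists[of "vec_nth v"] .
  define p where "p i = max (v $ i - c) 0" for i
  define q where "q i = max (c - v $ i) 0" for i
  have flow_sub: "h * card A \<le> boundary_flow L A" if "A \<subseteq> B" "2 * card B \<le> CARD('s)" for A B
    using that card_mono[of B A] by (intro flow) auto
  have P: "h\<^sup>2 / 2 * (\<Sum>i\<in>UNIV. (p i)\<^sup>2) \<le> dirichlet_form L p"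
  proof (rule cheeger_small_support[OF ds sym])
    fix A assume "A \<subseteq> {i. 0 < p i}"
    then show "h * card A \<le> boundary_flow L A"
      by (intro flow_sub[OF _ c(1)]) (auto simp: p_def)
  qed (simp_all add: p_def \<open>0 \<le> h\<close>)
  have Q: "h\<^sup>2 / 2 * (\<Sum>i\<in>UNIV. (q i)\<^sup>2) \<le> dirichlet_form L q"
  proof (rule cheeger_small_support[OF ds sym])
    fix A assume "A \<subseteq> {i. 0 < q i}"
    then show "h * card A \<le> boundary_flow L A"
      by (intro flow_sub[OF _ c(2)]) (auto simp: q_def)
  qed (simp_all add: q_def \<open>0 \<le> h\<close>)
  have "(norm v)\<^sup>2 = (\<Sum>i\<in>UNIV. (v $ i)\<^sup>2)"
    by (simp add: power2_norm_eq_inner) (simp add: inner_vec_def power2_eq_square)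
  also have "\<dots> \<le> (\<Sum>i\<in>UNIV. (v $ i)\<^sup>2) - 2 * c * (\<Sum>i\<in>UNIV. v $ i) + CARD('s) * c\<^sup>2"
    by (simp add: mean_zero)
  also have "\<dots> = (\<Sum>i\<in>UNIV. (p i)\<^sup>2 + (q i)\<^sup>2)"
  proof -
    have "(p i)\<^sup>2 + (q i)\<^sup>2 = (v $ i)\<^sup>2 - 2 * c * v $ i + c\<^sup>2" for i
      by (auto simp: p_def q_def max_def power2_eq_square algebra_simps)
    then show ?thesis by (simp add: sum.distrib sum_subtractf sum_distrib_left)
  qed
  finally have "h\<^sup>2 / 2 * (norm v)\<^sup>2 \<le> h\<^sup>2 / 2 * (\<Sum>i\<in>UNIV. (p i)\<^sup>2 + (q i)\<^sup>2)"
    by (intro mult_left_mono) auto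
  also have "\<dots> \<le> dirichlet_form L p + dirichlet_form L q"
    using P Q by (simp add: sum.distrib distrib_left)
  also have "\<dots> \<le> dirichlet_form L (vec_nth v)"
  proof -
    have "(p i - p j)\<^sup>2 + (q i - q j)\<^sup>2 \<le> (v $ i - v $ j)\<^sup>2" for i j
    proof -
      have "v $ i - v $ j = (p i - p j) - (q i - q j)" "(p i - p j) * (q i - q j) \<le> 0"
        by (auto simp: p_def q_def max_def mult_le_0_iff)
      then show ?thesis by (simp only: power2_diff)
    qed
    then show ?thesis
      unfolding dirichlet_form_def add_divide_distrib[symmetric] sum.distrib[symmetric] distrib_left[symmetric]
      by (intro divide_right_mono sum_mono mult_left_mono doubly_stochasticD[OF ds]) auto
  qed
  finally show ?thesis .
qed

section \<open>Products of doubly stochastic matrices\<close>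

lemma transition_matrix_mult:
  assumes "transition_matrix A" "transition_matrix B"
  shows "transition_matrix (A ** B)"
  unfolding transition_matrix_def
proof (intro conjI allI)
  fix i j
  show "0 \<le> (A ** B) $ i $ j"
    using assms by (auto simp: transition_matrix_def matrix_matrix_mult_def intro!: sum_nonneg)
  have "(\<Sum>j\<in>UNIV. (A ** B) $ i $ j) = (\<Sum>l\<in>UNIV. A $ i $ l * (\<Sum>j\<in>UNIV. B $ l $ j))"
    unfolding matrix_matrix_mult_def by (simp add: sum_distrib_left) (rule sum.swap)
  then show "(\<Sum>j\<in>UNIV. (A ** B) $ i $ j) = 1"
    using assms by (simp add: transition_matrix_def)
qed

lemma doubly_stochastic_mult:
  "doubly_stochastic A \<Longrightarrow> doubly_stochastic B \<Longrightarrow> doubly_stochastic (A ** B)"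
  by (simp add: doubly_stochastic_def transition_matrix_mult matrix_transpose_mul)

lemma doubly_stochastic_transpose: "doubly_stochastic A \<Longrightarrow> doubly_stochastic (transpose A)"
  by (simp add: doubly_stochastic_def)

lemma doubly_stochastic_permutation:
  assumes "bij f"
  shows "doubly_stochastic (permutation_matrix f)"
proof -
  have "(\<Sum>i\<in>UNIV. if j = f i then 1 else 0) = (1::real)" for j
  proof -
    have "j = f i \<longleftrightarrow> i = inv f j" for i
      using assms by (metis bij_inv_eq_iff)
    then show ?thesis by simp
  qed
  then show ?thesis
    by (auto simp: doubly_stochastic_def transition_matrix_def permutation_matrix_def transpose_def)
qed

lemma doubly_stochastic_uniform_stationary:
  fixes P :: "real ^ 's ^ 's"
  assumes "transition_matrix P" "stationary uniform P"
  shows "doubly_stochastic P"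
  using assms
  by (auto simp: doubly_stochastic_def transition_matrix_def stationary_def uniform_def transpose_def
      simp flip: sum_divide_distrib)

lemma sum_vector_doubly_stochastic:
  assumes "doubly_stochastic A"
  shows "(\<Sum>j\<in>UNIV. (v v* A) $ j) = (\<Sum>i\<in>UNIV. v $ i)"
proof -
  have "(\<Sum>j\<in>UNIV. (v v* A) $ j) = (\<Sum>i\<in>UNIV. \<Sum>j\<in>UNIV. A $ i $ j * v $ i)"
    unfolding vector_matrix_mult_def by simp (subst sum.swap, simp add: mult.commute)
  then show ?thesis by (simp add: doubly_stochastic_sum_left[OF assms])
qed

text \<open>
  For row vectors $\|v A\|^2 = \langle v, A A^T v\rangle$, so the loss of norm under $A$ is measured by
  the Dirichlet form of the symmetric matrix $A A^T$.
\<close>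

lemma norm_vector_doubly_stochastic:
  assumes "doubly_stochastic A"
  shows "(norm (v v* A))\<^sup>2 = (norm v)\<^sup>2 - dirichlet_form (A ** transpose A) (vec_nth v)"
proof -
  have "(norm (v v* A))\<^sup>2 = v \<bullet> ((A ** transpose A) *v v)"
    by (simp add: power2_norm_eq_inner dot_lmul_matrix flip: matrix_vector_mul_assoc)
  then show ?thesis
    using assms by (simp add: inner_doubly_stochastic_eq doubly_stochastic_mult doubly_stochastic_transpose)
qed

lemma norm_vector_doubly_stochastic_le:
  assumes "doubly_stochastic A"
  shows "norm (v v* A) \<le> norm v"
proof -
  have "doubly_stochastic (A ** transpose A)"
    using assms by (simp add: doubly_stochastic_mult doubly_stochastic_transpose)
  then have "(norm (v v* A))\<^sup>2 \<le> (norm v)\<^sup>2"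
    using norm_vector_doubly_stochastic[OF assms, of v] dirichlet_form_nonneg[of "A ** transpose A" "vec_nth v"]
    by simp
  then show ?thesis by (rule power2_le_imp_le) simp
qed

section \<open>Positivity patterns\<close>

lemma matrix_mult_pos_iff:
  assumes "transition_matrix A" "transition_matrix B"
  shows "0 < (A ** B) $ i $ j \<longleftrightarrow> (\<exists>l. 0 < A $ i $ l \<and> 0 < B $ l $ j)"
proof -
  have nn: "0 \<le> A $ i $ l" "0 \<le> B $ l $ j" for l
    using assms by (auto simp: transition_matrix_def)
  then have nn': "0 \<le> A $ i $ l * B $ l $ j" for l
    by simp
  have "0 < (\<Sum>l\<in>UNIV. A $ i $ l * B $ l $ j) \<longleftrightarrow> (\<Sum>l\<in>UNIV. A $ i $ l * B $ l $ j) \<noteq> 0"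
    using sum_nonneg[of UNIV "\<lambda>l. A $ i $ l * B $ l $ j"] nn' by (auto simp: less_le)
  also have "\<dots> \<longleftrightarrow> (\<exists>l. A $ i $ l * B $ l $ j \<noteq> 0)"
    by (subst sum_nonneg_eq_0_iff) (auto simp: nn')
  finally show ?thesis
    using nn by (auto simp: matrix_matrix_mult_def less_le)
qed

lemma expansion_mult:
  assumes "transition_matrix A" "transition_matrix B"
  shows "expansion (A ** B) S = expansion B (expansion A S)"
  by (auto simp: expansion_def matrix_mult_pos_iff[OF assms])

lemma expansion_permutation: "expansion (permutation_matrix f) S = f ` S"
  by (auto simp: expansion_def permutation_matrix_def)

definition pos_entries_ge :: "real ^ 's ^ 's \<Rightarrow> real \<Rightarrow> bool" where
  "pos_entries_ge A a \<longleftrightarrow> (\<forall>i j. 0 < A $ i $ j \<longrightarrow> a \<le> A $ i $ j)"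

lemma pos_entries_ge_mult:
  assumes "transition_matrix A" "transition_matrix B" "0 \<le> a" "0 \<le> b"
    and "pos_entries_ge A a" "pos_entries_ge B b"
  shows "pos_entries_ge (A ** B) (a * b)"
  unfolding pos_entries_ge_def
proof (intro allI impI)
  fix i j assume "0 < (A ** B) $ i $ j"
  then obtain l where l: "0 < A $ i $ l" "0 < B $ l $ j"
    using matrix_mult_pos_iff assms by blast
  then have "a * b \<le> A $ i $ l * B $ l $ j"
    using assms by (auto simp: pos_entries_ge_def intro!: mult_mono)
  also have "\<dots> \<le> (\<Sum>l\<in>UNIV. A $ i $ l * B $ l $ j)"
    using assms(1,2) by (intro member_le_sum) (auto simp: transition_matrix_def)
  finally show "a * b \<le> (A ** B) $ i $ j"
    by (simp add: matrix_matrix_mult_def)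
qed

lemma pos_entries_ge_transpose: "pos_entries_ge A a \<Longrightarrow> pos_entries_ge (transpose A) a"
  by (simp add: pos_entries_ge_def transpose_def)

lemma pos_entries_ge_permutation: "pos_entries_ge (permutation_matrix f) 1"
  by (simp add: pos_entries_ge_def permutation_matrix_def)

lemma min_pos_entry_bounds:
  fixes P :: "real ^ 's ^ 's"
  assumes "transition_matrix P" "\<And>i. 0 < P $ i $ i"
  shows "0 < min_pos_entry P" "min_pos_entry P \<le> 1" "pos_entries_ge P (min_pos_entry P)"
proof -
  let ?E = "{P $ i $ j | i j. P $ i $ j > 0}"
  have "?E \<subseteq> (\<lambda>(i, j). P $ i $ j) ` UNIV" by auto
  then have fin: "finite ?E" by (rule finite_subset) simp
  have le: "min_pos_entry P \<le> P $ i $ j" if "0 < P $ i $ j" for i j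
    unfolding min_pos_entry_def using that by (intro Min_le fin) auto
  then show "pos_entries_ge P (min_pos_entry P)" by (simp add: pos_entries_ge_def)
  have "?E \<noteq> {}" using assms(2) by auto
  then have "min_pos_entry P \<in> ?E" unfolding min_pos_entry_def by (intro Min_in fin)
  then show "0 < min_pos_entry P" by auto
  fix i :: 's
  have "P $ i $ i \<le> (\<Sum>j\<in>UNIV. P $ i $ j)"
    using assms by (intro member_le_sum) (auto simp: transition_matrix_def)
  then show "min_pos_entry P \<le> 1"
    using le[of i i] assms by (simp add: transition_matrix_def)
qed

text \<open>
  At least $|\mathcal{E}(A)| - |A|$ states are reached from $A$ and lie outside it, and a single
  positive entry already brings a flow of $a$ to each of them.
\<close>

lemma boundary_flow_ge:
  fixes L :: "real ^ 's ^ 's"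
  assumes "transition_matrix L" "pos_entries_ge L a" "0 \<le> a"
  shows "a * (real (card (expansion L A)) - real (card A)) \<le> boundary_flow L A"
proof -
  have "real (card (expansion L A)) - real (card A) \<le> real (card (expansion L A - A))"
    using diff_card_le_card_Diff[of A "expansion L A"] by simp
  then have "a * (real (card (expansion L A)) - real (card A)) \<le> (\<Sum>j\<in>expansion L A - A. a)"
    using assms(3) by (simp add: mult_left_mono mult.commute)
  also have "\<dots> \<le> (\<Sum>j\<in>expansion L A - A. \<Sum>i\<in>A. L $ i $ j)"
  proof (intro sum_mono)
    fix j assume "j \<in> expansion L A - A"
    then obtain i where i: "i \<in> A" "0 < L $ i $ j" by (auto simp: expansion_def)
    then have "a \<le> L $ i $ j" using assms by (auto simp: pos_entries_ge_def)
    also have "\<dots> \<le> (\<Sum>i\<in>A. L $ i $ j)"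
      using assms i by (intro member_le_sum) (auto simp: transition_matrix_def)
    finally show "a \<le> (\<Sum>i\<in>A. L $ i $ j)" .
  qed
  also have "\<dots> \<le> (\<Sum>j\<in>-A. \<Sum>i\<in>A. L $ i $ j)"
    using assms by (intro sum_mono2) (auto simp: transition_matrix_def intro!: sum_nonneg)
  also have "\<dots> = boundary_flow L A"
    unfolding boundary_flow_def by (rule sum.swap)
  finally show ?thesis .
qed

section \<open>Contraction of mean-zero vectors\<close>

text \<open>
  Cheeger's inequality for $L = K K^T$ with $K = P \Pi P$. Using the block $P \Pi P$ rather than
  $(\Pi P)^2$ makes the states reached from $A$ under $K$ exactly
  $\mathcal{E}(f(\mathcal{E}(A)))$, the set in the expansion hypothesis.
\<close>

lemma block_contraction:
  fixes P :: "real ^ 's ^ 's" and v :: "real ^ 's"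
  assumes ds: "doubly_stochastic P"
    and diag: "\<And>i. 0 < P $ i $ i"
    and pos: "pos_entries_ge P \<delta>" and "0 \<le> \<delta>" and "bij f" and "0 \<le> \<epsilon>"
    and expand: "\<And>A. 2 * card A \<le> CARD('s) \<Longrightarrow>
           (1 + \<epsilon>) * real (card A) \<le> real (card (expansion P (f ` expansion P A)))"
    and mean_zero: "(\<Sum>i\<in>UNIV. v $ i) = 0"
  shows "(norm (v v* (P ** permutation_matrix f ** P)))\<^sup>2 \<le> (1 - \<epsilon>\<^sup>2 * \<delta> ^ 8 / 2) * (norm v)\<^sup>2"
proof -
  define F :: "real ^ 's ^ 's" where "F = permutation_matrix f"
  define K where "K = P ** F ** P"
  define L where "L = K ** transpose K"
  have dsF: "doubly_stochastic F"
    using \<open>bij f\<close> by (simp add: F_def doubly_stochastic_permutation)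
  have dsK: "doubly_stochastic K"
    using ds dsF by (simp add: K_def doubly_stochastic_mult)
  have dsL: "doubly_stochastic L"
    using dsK by (simp add: L_def doubly_stochastic_mult doubly_stochastic_transpose)
  note tm = ds[unfolded doubly_stochastic_def] dsF[unfolded doubly_stochastic_def]
    dsK[unfolded doubly_stochastic_def] dsL[unfolded doubly_stochastic_def]
  have symL: "transpose L = L"
    by (simp add: L_def matrix_transpose_mul)
  have posF: "pos_entries_ge F 1"
    by (simp add: F_def pos_entries_ge_permutation)
  have posK: "pos_entries_ge K (\<delta> * 1 * \<delta>)"
    unfolding K_def using tm pos posF \<open>0 \<le> \<delta>\<close>
    by (intro pos_entries_ge_mult transition_matrix_mult) auto
  have posL: "pos_entries_ge L (\<delta> ^ 4)"
    using pos_entries_ge_mult[OF _ _ _ _ posK pos_entries_ge_transpose[OF posK]] tm \<open>0 \<le> \<delta>\<close>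
    by (simp add: L_def eval_nat_numeral mult.assoc)
  have grow: "card S \<le> card (expansion (transpose K) S)" for S
  proof -
    have incr: "card S \<le> card (expansion (transpose P) S)" for S
      by (intro card_mono) (auto simp: expansion_def transpose_def diag intro: diag)
    have incrF: "card S \<le> card (expansion (transpose F) S)" for S
    proof -
      have "expansion (transpose F) S = f -` S"
        by (auto simp: F_def expansion_def transpose_def permutation_matrix_def)
      then have "f ` expansion (transpose F) S = S"
        using \<open>bij f\<close> by (simp add: bij_is_surj surj_image_vimage_eq)
      then show ?thesis by (metis card_image_le finite)
    qed
    have "expansion (transpose K) S = expansion (transpose P) (expansion (transpose F) (expansion (transpose P) S))"
      using tm by (simp add: K_def matrix_transpose_mul expansion_mult transition_matrix_mult)
    then show ?thesis
      by (metis incr incrF order_trans)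
  qed
  have flow: "\<epsilon> * \<delta> ^ 4 * card A \<le> boundary_flow L A" if "2 * card A \<le> CARD('s)" for A
  proof -
    have "(1 + \<epsilon>) * real (card A) \<le> real (card (expansion K A))"
      using expand[OF that] tm
      by (simp add: K_def F_def expansion_mult transition_matrix_mult expansion_permutation)
    also have "\<dots> \<le> real (card (expansion L A))"
      using grow tm by (simp add: L_def expansion_mult)
    finally have "\<delta> ^ 4 * (\<epsilon> * card A) \<le> \<delta> ^ 4 * (real (card (expansion L A)) - real (card A))"
      using \<open>0 \<le> \<delta>\<close> by (intro mult_left_mono) (auto simp: algebra_simps)
    also have "\<dots> \<le> boundary_flow L A"
      using posL tm \<open>0 \<le> \<delta>\<close> by (intro boundary_flow_ge) auto
    finally show ?thesis by (simp add: algebra_simps)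
  qed
  have "(\<epsilon> * \<delta> ^ 4)\<^sup>2 / 2 * (norm v)\<^sup>2 \<le> dirichlet_form L (vec_nth v)"
    using \<open>0 \<le> \<delta>\<close> \<open>0 \<le> \<epsilon>\<close> flow by (intro cheeger_inequality dsL symL mean_zero) auto
  then show ?thesis
    using norm_vector_doubly_stochastic[OF dsK, of v]
    by (simp add: L_def K_def F_def power_mult_distrib algebra_simps flip: power_mult)
qed

section \<open>Laws of the Markov chain\<close>

text \<open>
  The Markov property is given for complete histories only, so both sides are decomposed over the
  finitely many histories up to time $k$. Histories of probability zero contribute nothing.
\<close>

lemma markov_chain_joint_step:
  fixes X :: "nat \<Rightarrow> 'w \<Rightarrow> 's::finite"
  assumes mc: "markov_chain M X Q"
  shows "\<P>(\<omega> in M. X (Suc k) \<omega> = j \<and> X 0 \<omega> = i)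
       = (\<Sum>l\<in>UNIV. \<P>(\<omega> in M. X k \<omega> = l \<and> X 0 \<omega> = i) * Q $ l $ j)"
proof -
  interpret prob_space M using mc by (simp add: markov_chain_def)
  have [measurable]: "X m \<in> measurable M (count_space UNIV)" for m
    using mc by (simp add: markov_chain_def)
  (* Functions that are undefined beyond k represent each history exactly once. *)
  define H where "H = (PiE {..k} (\<lambda>_. UNIV) :: (nat \<Rightarrow> 's) set)"
  define h where "h x = \<P>(\<omega> in M. \<forall>m\<le>k. X m \<omega> = x m)" for x
  have finH: "finite H" by (simp add: H_def finite_PiE)
  have decomp: "\<P>(\<omega> in M. E \<omega>) = (\<Sum>x\<in>H. \<P>(\<omega> in M. E \<omega> \<and> (\<forall>m\<le>k. X m \<omega> = x m)))"
    if [measurable]: "Measurable.pred M E" for E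
  proof -
    have "{\<omega> \<in> space M. E \<omega>} = (\<Union>x\<in>H. {\<omega> \<in> space M. E \<omega> \<and> (\<forall>m\<le>k. X m \<omega> = x m)})"
    proof (intro equalityI subsetI)
      fix \<omega> assume "\<omega> \<in> {\<omega> \<in> space M. E \<omega>}"
      then show "\<omega> \<in> (\<Union>x\<in>H. {\<omega> \<in> space M. E \<omega> \<and> (\<forall>m\<le>k. X m \<omega> = x m)})"
        by (intro UN_I[of "restrict (\<lambda>m. X m \<omega>) {..k}"]) (auto simp: H_def)
    qed auto
    moreover have "disjoint_family_on (\<lambda>x. {\<omega> \<in> space M. E \<omega> \<and> (\<forall>m\<le>k. X m \<omega> = x m)}) H"
    proof (unfold disjoint_family_on_def, intro ballI impI)
      fix x y assume "x \<in> H" "y \<in> H" "x \<noteq> y"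
      then obtain m where "m \<le> k" "x m \<noteq> y m"
        by (auto simp: H_def) (metis PiE_ext atMost_iff)
      then show "{\<omega> \<in> space M. E \<omega> \<and> (\<forall>m\<le>k. X m \<omega> = x m)} \<inter> {\<omega> \<in> space M. E \<omega> \<and> (\<forall>m\<le>k. X m \<omega> = y m)} = {}"
        by auto
    qed
    ultimately show ?thesis
      using finH by (simp add: finite_measure_finite_Union image_subset_iff)
  qed
  have step: "\<P>(\<omega> in M. (X (Suc k) \<omega> = j \<and> X 0 \<omega> = i) \<and> (\<forall>m\<le>k. X m \<omega> = x m))
      = (if x 0 = i then h x * Q $ x k $ j else 0)" for x
  proof (cases "x 0 = i")
    case True
    then have eq: "{\<omega> \<in> space M. (X (Suc k) \<omega> = j \<and> X 0 \<omega> = i) \<and> (\<forall>m\<le>k. X m \<omega> = x m)}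
        = {\<omega> \<in> space M. X (Suc k) \<omega> = j \<and> (\<forall>m\<le>k. X m \<omega> = x m)}"
      by auto
    show ?thesis
    proof (cases "h x > 0")
      case pos: True
      then have "\<P>(\<omega> in M. X (Suc k) \<omega> = j \<and> (\<forall>m\<le>k. X m \<omega> = x m)) / h x = Q $ x k $ j"
        using mc unfolding markov_chain_def cond_prob_def h_def by blast
      then show ?thesis using True pos by (simp only: eq) (simp add: field_simps)
    next
      case False
      then have "h x = 0" by (simp add: h_def not_less measure_le_0_iff)
      moreover have "\<P>(\<omega> in M. X (Suc k) \<omega> = j \<and> (\<forall>m\<le>k. X m \<omega> = x m)) \<le> h x"
        unfolding h_def by (intro finite_measure_mono) auto
      ultimately show ?thesis using True by (simp only: eq) (simp add: measure_le_0_iff)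
    qed
  next
    case False
    then have "{\<omega> \<in> space M. (X (Suc k) \<omega> = j \<and> X 0 \<omega> = i) \<and> (\<forall>m\<le>k. X m \<omega> = x m)} = {}"
      by auto
    then show ?thesis using False by (simp only:) simp
  qed
  have now: "\<P>(\<omega> in M. (X k \<omega> = l \<and> X 0 \<omega> = i) \<and> (\<forall>m\<le>k. X m \<omega> = x m))
      = (if x 0 = i \<and> x k = l then h x else 0)" for x l
  proof (cases "x 0 = i \<and> x k = l")
    case True
    then show ?thesis by (auto simp: h_def intro!: arg_cong[of _ _ prob])
  next
    case False
    then have "{\<omega> \<in> space M. (X k \<omega> = l \<and> X 0 \<omega> = i) \<and> (\<forall>m\<le>k. X m \<omega> = x m)} = {}"
      by auto
    then show ?thesis using False by (simp only:) simp
  qed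
  have "\<P>(\<omega> in M. X (Suc k) \<omega> = j \<and> X 0 \<omega> = i) = (\<Sum>x\<in>H. if x 0 = i then h x * Q $ x k $ j else 0)"
    by (subst decomp) (simp_all only: step, measurable)
  also have "\<dots> = (\<Sum>x\<in>H. \<Sum>l\<in>UNIV. (if x 0 = i \<and> x k = l then h x else 0) * Q $ l $ j)"
  proof (intro sum.cong refl)
    fix x
    have "(\<Sum>l\<in>UNIV. (if x 0 = i \<and> x k = l then h x else 0) * Q $ l $ j)
        = (\<Sum>l\<in>UNIV. if x k = l then (if x 0 = i then h x * Q $ l $ j else 0) else 0)"
      by (intro sum.cong) auto
    then show "(if x 0 = i then h x * Q $ x k $ j else 0)
        = (\<Sum>l\<in>UNIV. (if x 0 = i \<and> x k = l then h x else 0) * Q $ l $ j)"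
      by simp
  qed
  also have "\<dots> = (\<Sum>l\<in>UNIV. (\<Sum>x\<in>H. if x 0 = i \<and> x k = l then h x else 0) * Q $ l $ j)"
    by (subst sum.swap) (simp add: sum_distrib_right)
  also have "\<dots> = (\<Sum>l\<in>UNIV. \<P>(\<omega> in M. X k \<omega> = l \<and> X 0 \<omega> = i) * Q $ l $ j)"
    by (intro sum.cong refl arg_cong2[of _ _ _ _ times], subst decomp) (simp_all only: now, measurable)
  finally show ?thesis .
qed

lemma law_given_start_Suc:
  fixes X :: "nat \<Rightarrow> 'w \<Rightarrow> 's::finite"
  assumes "markov_chain M X Q"
  shows "(\<chi> j. law_given_start M X i (Suc k) j) = (\<chi> j. law_given_start M X i k j) v* Q"
  by (simp add: vec_eq_iff law_given_start_def cond_prob_def vector_matrix_mult_def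
      markov_chain_joint_step[OF assms] sum_divide_distrib mult.commute)

lemma law_given_start_0:
  assumes "\<P>(\<omega> in M. X 0 \<omega> = i) > 0"
  shows "law_given_start M X i 0 j = (if j = i then 1 else 0)"
proof (cases "j = i")
  case True
  then show ?thesis using assms by (simp add: law_given_start_def cond_prob_def)
next
  case False
  then have "{\<omega> \<in> space M. X 0 \<omega> = j \<and> X 0 \<omega> = i} = {}" by auto
  then show ?thesis using False unfolding law_given_start_def cond_prob_def by (simp only:) simp
qed

lemma tv_dist_le_norm:
  fixes \<nu> \<mu> :: "'s::finite \<Rightarrow> real"
  shows "tv_dist \<nu> \<mu> \<le> sqrt CARD('s) / 2 * norm (\<chi> j. \<nu> j - \<mu> j)"
proof -
  have "(\<Sum>j\<in>UNIV. \<bar>\<nu> j - \<mu> j\<bar>) \<le> sqrt (CARD('s) * (\<Sum>j\<in>UNIV. \<bar>\<nu> j - \<mu> j\<bar>\<^sup>2))"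
    using sum_squared_le_sum_of_squares[of "\<lambda>j. \<bar>\<nu> j - \<mu> j\<bar>" UNIV]
    by - (rule real_le_rsqrt, simp add: mult.commute)
  also have "\<dots> = sqrt CARD('s) * norm (\<chi> j. \<nu> j - \<mu> j)"
    by (simp add: real_sqrt_mult norm_eq_sqrt_inner inner_vec_def power2_eq_square)
  finally show ?thesis by (simp add: tv_dist_def)
qed

lemma norm_deviation_start:
  "norm (\<chi> j. (if j = i then 1 else 0) - uniform j :: real ^ 's) \<le> 1"
proof -
  let ?n = "real CARD('s)"
  have "(norm (\<chi> j. (if j = i then 1 else 0) - uniform j :: real ^ 's))\<^sup>2
      = (\<Sum>j\<in>UNIV. (if j = i then 1 - 2 / ?n else 0) + 1 / ?n\<^sup>2)"
    unfolding power2_norm_eq_inner inner_vec_def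
    by (intro sum.cong refl) (auto simp: uniform_def power2_eq_square field_simps)
  also have "\<dots> = 1 - 1 / ?n"
    unfolding sum.distrib by (simp add: power2_eq_square field_simps)
  finally show ?thesis
    by - (rule power2_le_imp_le, simp_all)
qed

lemma uniform_vector_invariant:
  assumes "doubly_stochastic A"
  shows "(\<chi> j. uniform j) v* A = (\<chi> j. uniform j)"
  by (simp add: vec_eq_iff vector_matrix_mult_def uniform_def doubly_stochasticD[OF assms]
      flip: sum_divide_distrib)

lemma deviation_Suc:
  fixes X :: "nat \<Rightarrow> 'w \<Rightarrow> 's::finite"
  assumes "markov_chain M X Q" "doubly_stochastic Q"
  shows "(\<chi> j. law_given_start M X i (Suc k) j - uniform j)
       = (\<chi> j. law_given_start M X i k j - uniform j) v* Q"
proof -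
  have split: "(\<chi> j. a j - b j) = (\<chi> j. a j) - (\<chi> j. b j)" for a b :: "'s \<Rightarrow> real"
    by (simp add: vec_eq_iff)
  show ?thesis
    unfolding split vector_matrix_mult_diff_distrib law_given_start_Suc[OF assms(1)]
      uniform_vector_invariant[OF assms(2)] ..
qed

section \<open>Mixing of the chain\<close>

theorem theorem2p1:
  fixes P :: "real ^ 's ^ 's" and f :: "'s \<Rightarrow> 's" and Q :: "real ^ 's ^ 's"
    and \<epsilon> \<delta> :: real
    and M :: "'w measure" and X :: "nat \<Rightarrow> 'w \<Rightarrow> 's"
    and i :: 's and k :: nat
  assumes "transition_matrix P"
    and "irreducible_matrix P" and "aperiodic_matrix P"
    and "\<forall>i j. P $ i $ j > 0 \<longrightarrow> P $ j $ i > 0"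
    and "\<forall>i. P $ i $ i > 0"
    and "stationary uniform P"
    and "\<delta> = min_pos_entry P"
    and "bij f"
    and "Q = permutation_matrix f ** P"
    and "0 < \<epsilon>" and "\<epsilon> < 1"
    and "\<forall>A :: 's set. real (card A) \<le> real CARD('s) / 2 \<longrightarrow>
           real (card (expansion P (f ` expansion P A))) \<ge> (1 + \<epsilon>) * real (card A)"
    and "markov_chain M X Q"
    and "\<P>(\<omega> in M. X 0 \<omega> = i) > 0"
    and "k \<ge> 1"
  shows "tv_dist (law_given_start M X i k) uniform
           \<le> sqrt (real CARD('s)) / 2 * (1 - \<epsilon>\<^sup>2 * \<delta> ^ 8 / 2) powr ((real k - 2) / 4)"
proof -
  note expand = assms(12) and mc = assms(13)
  let ?F = "permutation_matrix f :: real ^ 's ^ 's"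
  define b where "b = 1 - \<epsilon>\<^sup>2 * \<delta> ^ 8 / 2"
  have \<delta>: "0 < \<delta>" "\<delta> \<le> 1" "pos_entries_ge P \<delta>"
    using min_pos_entry_bounds[of P] assms(1,5,7) by auto
  have "\<epsilon>\<^sup>2 * \<delta> ^ 8 \<le> 1 * 1"
    using \<delta> assms(10,11) by (intro mult_mono power_le_one) auto
  then have b: "0 < b" "b \<le> 1"
    using \<delta> by (auto simp: b_def)
  have dsP: "doubly_stochastic P"
    using assms(1,6) by (rule doubly_stochastic_uniform_stationary)
  have dsF: "doubly_stochastic ?F"
    using assms(8) by (rule doubly_stochastic_permutation)
  have dsQ: "doubly_stochastic Q"
    using dsP dsF by (simp add: assms(9) doubly_stochastic_mult)
  define d where "d m = (\<chi> j. law_given_start M X i m j - uniform j)" for m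
  have d_Suc: "d (Suc m) = d m v* Q" for m
    unfolding d_def by (rule deviation_Suc[OF mc dsQ])
  have d_0: "norm (d 0) \<le> 1" and sum_0: "(\<Sum>j\<in>UNIV. d 0 $ j) = 0"
    using norm_deviation_start[of i] assms(14)
    by (simp_all add: d_def law_given_start_0 sum_subtractf uniform_def)
  have sum_d: "(\<Sum>j\<in>UNIV. d m $ j) = 0" for m
    by (induction m) (simp_all add: sum_0 d_Suc sum_vector_doubly_stochastic[OF dsQ])
  have two_steps: "(norm (d (Suc (Suc m))))\<^sup>2 \<le> b * (norm (d m))\<^sup>2" for m
  proof -
    (* Regroup the two steps so that the leading permutation is split off as an isometry. *)
    have "d (Suc (Suc m)) = (d m v* ?F) v* (P ** ?F ** P)"
      by (simp add: d_Suc assms(9) vector_matrix_mul_assoc matrix_mul_assoc)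
    moreover have "(\<Sum>j\<in>UNIV. (d m v* ?F) $ j) = 0"
      by (simp add: sum_vector_doubly_stochastic[OF dsF] sum_d)
    ultimately have "(norm (d (Suc (Suc m))))\<^sup>2 \<le> b * (norm (d m v* ?F))\<^sup>2"
      unfolding b_def using assms(5,8,10) expand \<delta>
      by (simp only:) (intro block_contraction dsP, auto)
    also have "\<dots> \<le> b * (norm (d m))\<^sup>2"
      using b norm_vector_doubly_stochastic_le[OF dsF] by (intro mult_left_mono power_mono) auto
    finally show ?thesis .
  qed
  have even: "(norm (d (2 * m)))\<^sup>2 \<le> b ^ m" for m
  proof (induction m)
    case 0
    then show ?case using d_0 by (simp add: power_le_one)
  next
    case (Suc m)
    have "(norm (d (2 * Suc m)))\<^sup>2 \<le> b * (norm (d (2 * m)))\<^sup>2"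
      using two_steps[of "2 * m"] by simp
    also have "\<dots> \<le> b * b ^ m" using Suc b by (intro mult_left_mono) auto
    finally show ?case by simp
  qed
  have "norm (d k) \<le> norm (d (2 * (k div 2)))"
  proof (cases "even k")
    case False
    then have "k = Suc (2 * (k div 2))" by presburger
    then show ?thesis
      by (metis d_Suc norm_vector_doubly_stochastic_le[OF dsQ])
  qed simp
  also have "\<dots> \<le> sqrt (b ^ (k div 2))"
    using even by (rule real_le_rsqrt)
  also have "\<dots> = b powr (real (k div 2) / 2)"
    using b by (simp add: powr_half_sqrt[symmetric] powr_powr flip: powr_realpow)
  also have "\<dots> \<le> b powr ((real k - 2) / 4)"
  proof (rule powr_mono')
    have "k \<le> 2 * (k div 2) + 2" by linarith
    then have "real k \<le> 2 * real (k div 2) + 2" by linarith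
    then show "(real k - 2) / 4 \<le> real (k div 2) / 2" by simp
  qed (use b in auto)
  finally have "sqrt CARD('s) / 2 * norm (d k) \<le> sqrt CARD('s) / 2 * b powr ((real k - 2) / 4)"
    by (intro mult_left_mono) auto
  then show ?thesis
    using order_trans[OF tv_dist_le_norm[of "law_given_start M X i k" uniform]] unfolding d_def b_def
    by blast
qed

end
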